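(* Let $n\ge2$ and let $\{P_\theta\}_{\theta\in\mathbb{R}}$ be a regular one-parameter exponential family with log-partition function $b$. Assume that the image of $b'$ is $\mathbb{R}$ and that $$\lim_{\theta\to-\infty}\frac{b'(\theta)}{\sqrt{b''(\theta)}}=-\infty,\qquad \lim_{\theta\to\infty}\frac{b'(\theta)}{\sqrt{b''(\theta)}}=\infty .$$ Let $\mathcal S$ be any linear knowledge partition of $\mathbb{R}^n$ cut by $(n-1)$-dimensional affine hyperplanes $H_1,\dots,H_K$. If $\mathcal S$ is truthful (with respect to $\{P_\theta\}$), then for each $1\le k\le K$ there exist indices $1\le i_k<j_k\le n$ and a constant $t_k\in\mathbb{R}$ such that $$H_k=\{\boldsymbol x\in\mathbb{R}^n:\ x_{i_k}-x_{j_k}=t_k\}.$$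
   Context: Regular one-parameter exponential family: there are a base measure $\rho$ on $\mathbb{R}$, a carrier function $c\ge0$ and a log-partition function $b$ such that $P_\theta$ has density $p_\theta(x)=e^{\theta x-b(\theta)}c(x)$ with respect to $\rho$; $b$ is twice differentiable with $b''>0$. One has $\mathbb{E}_\theta[X]=b'(\theta)$ and $\mathrm{Var}_\theta(X)=b''(\theta)$. Knowledge partition: a collection $\mathcal S$ of pairwise disjoint subsets of $\mathbb{R}^n$ whose union is $\mathbb{R}^n$; its members are called knowledge elements. It is linear, cut by the hyperplanes $H_1,\dots,H_K$ (finitely many, distinct), if its elements are the regions enclosed by these hyperplanes with no hyperplane passing through the interior of any element; that is, each $S\in\mathcal S$ satisfies $C\subseteq S\subseteq\overline{C}$ for a connected component $C$ of $\mathbb{R}^n\setminus\bigcup_k H_k$ (with every component arising in this way). Mechanism: given independent $X_i\sim P_{\theta_i^\star}$, $i=1,\dots,n$, with mean vector $\boldsymbol\mu^\star=(b'(\theta_1^\star),\dots,b'(\theta_n^\star))$, and a reported element $S\in\mathcal S$, let $\widehat{\boldsymbol\mu}^S$ be the Euclidean projection of $\boldsymbol X=(X_1,\dots,X_n)$ onto $S$ (i.e. the minimizer of $\sum_i(X_i-\mu_i)^2$ over $\boldsymbol\mu\in\overline S$). For nondecreasing convex $U:\mathbb{R}\to\mathbb{R}$ let $\mathsf{Util}(S)=\mathbb{E}\big[\sum_{i=1}^nU(\widehat\mu^S_i)\big]\in(-\infty,+\infty]$. Truthful: $\mathcal S$ is truthful if for all parameters $\theta_1^\star,\dots,\theta_n^\star$,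 for every nondecreasing convex $U:\mathbb{R}\to\mathbb{R}$, and for the unique $S^\star\in\mathcal S$ containing $\boldsymbol\mu^\star$, one has $\mathsf{Util}(S^\star)\ge\mathsf{Util}(S)$ for every $S\in\mathcal S$. *)

theory Defs
  imports "HOL-Probability.Probability"
begin

definition exp_family :: "real measure \<Rightarrow> (real \<Rightarrow> real) \<Rightarrow> (real \<Rightarrow> real) \<Rightarrow> real \<Rightarrow> real measure" where
  "exp_family \<rho> c b \<theta> = density \<rho> (\<lambda>x. ennreal (exp (\<theta> * x - b \<theta>) * c x))"

text \<open>The identities for mean and variance (namely \<open>b'\<close> and \<open>b''\<close>) are consequences and
  therefore not part of the definition.\<close>

definition regular_exp_family :: "real measure \<Rightarrow> (real \<Rightarrow> real) \<Rightarrow> (real \<Rightarrow> real) \<Rightarrow> bool" where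
  "regular_exp_family \<rho> c b \<longleftrightarrow>
     sets \<rho> = sets borel \<and> c \<in> borel_measurable borel \<and> (\<forall>x. 0 \<le> c x) \<and>
     (\<forall>\<theta>. prob_space (exp_family \<rho> c b \<theta>)) \<and>
     (\<forall>\<theta>. b differentiable (at \<theta>)) \<and> (\<forall>\<theta>. deriv b differentiable (at \<theta>)) \<and>
     (\<forall>\<theta>. 0 < deriv (deriv b) \<theta>)"

definition knowledge_partition :: "'a set set \<Rightarrow> bool" where
  "knowledge_partition \<S> \<longleftrightarrow> disjoint \<S> \<and> \<Union>\<S> = UNIV"

definition affine_hyperplane :: "'a::euclidean_space set \<Rightarrow> bool" where
  "affine_hyperplane H \<longleftrightarrow> affine H \<and> aff_dim H = int DIM('a) - 1"

text \<open>The hyperplanes cutting the space are \<open>H 1, \<dots>, H K\<close>; values of \<open>H\<close> at other indices are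
  irrelevant.  The elements may contain an arbitrary part of the boundary of their region.\<close>

definition linear_knowledge_partition ::
    "'a::euclidean_space set set \<Rightarrow> nat \<Rightarrow> (nat \<Rightarrow> 'a set) \<Rightarrow> bool" where
  "linear_knowledge_partition \<S> K H \<longleftrightarrow>
     knowledge_partition \<S> \<and>
     (\<forall>k\<in>{1..K}. affine_hyperplane (H k)) \<and> inj_on H {1..K} \<and>
     (\<forall>S\<in>\<S>. \<exists>C\<in>components (UNIV - (\<Union>k\<in>{1..K}. H k)). C \<subseteq> S \<and> S \<subseteq> closure C) \<and>
     (\<forall>C\<in>components (UNIV - (\<Union>k\<in>{1..K}. H k)). \<exists>S\<in>\<S>. C \<subseteq> S \<and> S \<subseteq> closure C)"

text \<open>Expectation of an arbitrary real random variable as an extended real.  It is meaningful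
  whenever the positive or the negative part of \<open>f\<close> has finite expectation; below, the
  negative part always does, since a convex function is bounded below by an affine one.\<close>

definition ext_expectation :: "'a measure \<Rightarrow> ('a \<Rightarrow> real) \<Rightarrow> ereal" where
  "ext_expectation M f =
     enn2ereal (\<integral>\<^sup>+x. ennreal (f x) \<partial>M) - enn2ereal (\<integral>\<^sup>+x. ennreal (- f x) \<partial>M)"

text \<open>The expected utility depends only on the joint law of the observations, so the independent
  \<open>X\<^sub>i\<close> with laws \<open>P (\<theta> $ i)\<close> are realised as the coordinates of the product probability space.\<close>

definition Util ::
    "(real \<Rightarrow> real measure) \<Rightarrow> real^'n \<Rightarrow> (real \<Rightarrow> real) \<Rightarrow> (real^'n) set \<Rightarrow> ereal" where
  "Util P \<theta> U S =
     ext_expectation (Pi\<^sub>M UNIV (\<lambda>i. P (\<theta> $ i)))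
       (\<lambda>X. \<Sum>i\<in>UNIV. U (closest_point (closure S) (\<chi> j. X j) $ i))"

definition truthful ::
    "(real \<Rightarrow> real measure) \<Rightarrow> (real \<Rightarrow> real) \<Rightarrow> (real^'n) set set \<Rightarrow> bool" where
  "truthful P b \<S> \<longleftrightarrow>
     (\<forall>\<theta> :: real^'n. \<forall>U. mono U \<and> convex_on UNIV U \<longrightarrow>
        (\<forall>S'\<in>\<S>. (\<chi> i. deriv b (\<theta> $ i)) \<in> S' \<longrightarrow>
           (\<forall>S\<in>\<S>. Util P \<theta> U S' \<ge> Util P \<theta> U S)))"

end

theory Submission imports Defs begin

text \<open>Suppose \<open>H\<^sub>k\<close> has a normal vector \<open>v\<close> that is not a multiple of any \<open>e\<^sub>i - e\<^sub>j\<close>.  Then there is a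
  direction \<open>w\<close> of \<open>H\<^sub>k\<close> with pairwise distinct coordinates that is transversal to all hyperplanes not
  parallel to \<open>H\<^sub>k\<close>.  Let the mean vector be \<open>R (w - \<epsilon> u)\<close> with \<open>u = \<plusminus> v\<close> and \<open>R \<rightarrow> \<infinity>\<close>.  The growth
  condition makes the deviations of the observations \<open>o(R)\<close>, so after rescaling by \<open>R\<close> truthfulness
  becomes a deterministic statement.  The truthful report yields \<open>w - \<epsilon> u\<close>, whereas the element that
  lies far out near the ray \<open>R w\<close>, on the side \<open>u\<close> of all hyperplanes parallel to \<open>H\<^sub>k\<close>, yields
  \<open>w\<close>.  Hence \<open>\<Sum> max 0 (w\<^sub>i - s) \<le> \<Sum> max 0 (w\<^sub>i - \<epsilon> u\<^sub>i - s)\<close> for all \<open>s\<close>.  For \<open>s\<close> slightly below the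
  largest \<open>w\<^sub>i\<close> with \<open>u\<^sub>i \<noteq> 0\<close> only this coordinate contributes to the difference, and the sign of
  \<open>u\<close> can be chosen to make the inequality fail.\<close>

section \<open>Exponential families\<close>

text \<open>This is \<open>cosh y \<ge> 1 + y^2 / 2\<close>. For nonnegative arguments the
  difference of the two sides has as derivative the expression in \<open>sinh_ge\<close>, whose own
  derivative is nonnegative; both vanish suitably at 0, and evenness covers negative
  \<open>y\<close>.\<close>

lemma exp_plus_exp_minus_ge: "2 + y\<^sup>2 \<le> exp y + exp (- y)" for y :: real
proof -
  have sinh_ge: "2 * t \<le> exp t - exp (- t)" if "0 \<le> t" for t :: real
  proof -
    have "exp 0 - exp (- 0) - 2 * 0 \<le> exp t - exp (- t) - 2 * t"
    proof (rule DERIV_nonneg_imp_nondecreasing[OF that])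
      fix x :: real
      have "((\<lambda>t. exp t - exp (- t) - 2 * t) has_real_derivative exp x + exp (- x) - 2) (at x)"
        by (auto intro!: derivative_eq_intros)
      moreover have "0 \<le> exp x + exp (- x) - 2"
        using exp_ge_add_one_self[of x] exp_ge_add_one_self[of "- x"] by linarith
      ultimately show "\<exists>y. ((\<lambda>t. exp t - exp (- t) - 2 * t) has_real_derivative y) (at x) \<and> 0 \<le> y"
        by blast
    qed
    then show ?thesis by simp
  qed
  have nonneg: "2 + t\<^sup>2 \<le> exp t + exp (- t)" if "0 \<le> t" for t :: real
  proof -
    have "exp 0 + exp (- 0) - 0\<^sup>2 \<le> exp t + exp (- t) - t\<^sup>2"
    proof (rule DERIV_nonneg_imp_nondecreasing[OF that])
      fix x :: real assume "0 \<le> x"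
      moreover have "((\<lambda>t. exp t + exp (- t) - t\<^sup>2) has_real_derivative exp x - exp (- x) - 2 * x) (at x)"
        by (auto intro!: derivative_eq_intros)
      ultimately show "\<exists>y. ((\<lambda>t. exp t + exp (- t) - t\<^sup>2) has_real_derivative y) (at x) \<and> 0 \<le> y"
        using sinh_ge[of x] by (intro exI[of _ "exp x - exp (- x) - 2 * x"]) auto
    qed
    then show ?thesis by simp
  qed
  show ?thesis
    using nonneg[of y] nonneg[of "- y"] by (cases "0 \<le> y") (auto simp: add.commute)
qed

context
  fixes \<rho> :: "real measure" and c b :: "real \<Rightarrow> real"
  assumes reg: "regular_exp_family \<rho> c b"
begin

lemma sets_base: "sets \<rho> = sets borel"
  using reg by (simp add: regular_exp_family_def)

lemma measurable_carrier: "c \<in> borel_measurable borel"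
  using reg by (simp add: regular_exp_family_def)

lemma sets_exp_family: "sets (exp_family \<rho> c b \<theta>) = sets borel"
  by (simp add: exp_family_def sets_base)

lemma prob_space_exp_family: "prob_space (exp_family \<rho> c b \<theta>)"
  using reg by (simp add: regular_exp_family_def)

lemma DERIV_log_partition: "(b has_real_derivative deriv b \<theta>) (at \<theta>)"
  using reg by (auto simp: regular_exp_family_def DERIV_deriv_iff_real_differentiable)

lemma DERIV_deriv_log_partition: "(deriv b has_real_derivative deriv (deriv b) \<theta>) (at \<theta>)"
  using reg by (auto simp: regular_exp_family_def DERIV_deriv_iff_real_differentiable)

lemma deriv2_log_partition_pos: "0 < deriv (deriv b) \<theta>"
  using reg by (simp add: regular_exp_family_def)

lemma strict_mono_deriv_log_partition: "strict_mono (deriv b)"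
  by (rule strict_monoI, rule DERIV_pos_imp_increasing)
     (use DERIV_deriv_log_partition deriv2_log_partition_pos in blast)+

section \<open>Moment bounds by exponential tilting\<close>

lemma nn_integral_exp_family:
  assumes [measurable]: "f \<in> borel_measurable borel"
  shows "(\<integral>\<^sup>+x. f x \<partial>exp_family \<rho> c b \<theta>) =
    (\<integral>\<^sup>+x. ennreal (exp (\<theta> * x - b \<theta>) * c x) * f x \<partial>\<rho>)"
proof -
  note [measurable_cong] = sets_base sets_exp_family and [measurable] = measurable_carrier
  show ?thesis
    unfolding exp_family_def by (subst nn_integral_density) auto
qed

text \<open>Tilting: multiplying the density at \<open>\<theta>\<close> by
  \<open>exp (h * (x - m))\<close> gives a constant times the density at
  \<open>\<theta> + h\<close>, which has total mass 1.\<close>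

lemma exp_family_mgf:
  "(\<integral>\<^sup>+x. ennreal (exp (h * (x - m))) \<partial>exp_family \<rho> c b \<theta>) =
    ennreal (exp (b (\<theta> + h) - b \<theta> - h * m))"
proof -
  note [measurable_cong] = sets_base sets_exp_family and [measurable] = measurable_carrier
  have c0: "0 \<le> c x" for x
    using reg by (simp add: regular_exp_family_def)
  let ?E = "exp (b (\<theta> + h) - b \<theta> - h * m)"
  have "(\<integral>\<^sup>+x. ennreal (exp (h * (x - m))) \<partial>exp_family \<rho> c b \<theta>) =
    (\<integral>\<^sup>+x. ennreal (exp (\<theta> * x - b \<theta>) * c x) * ennreal (exp (h * (x - m))) \<partial>\<rho>)"
    by (rule nn_integral_exp_family) measurable
  also have "\<dots> = (\<integral>\<^sup>+x. ennreal ?E * (ennreal (exp ((\<theta> + h) * x - b (\<theta> + h)) * c x) * 1) \<partial>\<rho>)"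
  proof (rule nn_integral_cong)
    fix x
    have "exp (\<theta> * x - b \<theta>) * exp (h * (x - m)) = ?E * exp ((\<theta> + h) * x - b (\<theta> + h))"
      unfolding exp_add[symmetric] by (rule arg_cong[of _ _ exp]) (simp add: algebra_simps)
    then have "exp (\<theta> * x - b \<theta>) * c x * exp (h * (x - m)) =
        ?E * (exp ((\<theta> + h) * x - b (\<theta> + h)) * c x)"
      by (metis mult.assoc mult.commute)
    then show "ennreal (exp (\<theta> * x - b \<theta>) * c x) * ennreal (exp (h * (x - m))) =
        ennreal ?E * (ennreal (exp ((\<theta> + h) * x - b (\<theta> + h)) * c x) * 1)"
      using c0 by (simp add: ennreal_mult[symmetric])
  qed
  also have "\<dots> = ennreal ?E * (\<integral>\<^sup>+x. ennreal (exp ((\<theta> + h) * x - b (\<theta> + h)) * c x) * 1 \<partial>\<rho>)"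
    by (rule nn_integral_cmult) measurable
  also have "(\<integral>\<^sup>+x. ennreal (exp ((\<theta> + h) * x - b (\<theta> + h)) * c x) * 1 \<partial>\<rho>) =
      (\<integral>\<^sup>+x. 1 \<partial>exp_family \<rho> c b (\<theta> + h))"
    by (rule nn_integral_exp_family[symmetric]) simp
  also have "\<dots> = 1"
    using prob_space.emeasure_space_1[OF prob_space_exp_family] by simp
  finally show ?thesis by simp
qed

text \<open>Differentiation under the integral sign is avoided: the second symmetric difference
  quotient of the moment generating function of \<open>X - b' \<theta>\<close> at \<open>0\<close> dominates the second moment.\<close>

lemma exp_family_second_moment_le:
  "(\<integral>\<^sup>+x. ennreal ((x - deriv b \<theta>)\<^sup>2) \<partial>exp_family \<rho> c b \<theta>) \<le> ennreal (deriv (deriv b) \<theta>)"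
proof -
  interpret prob_space "exp_family \<rho> c b \<theta>" by (rule prob_space_exp_family)
  note [measurable_cong] = sets_exp_family
  let ?P = "exp_family \<rho> c b \<theta>"
  define m where "m = deriv b \<theta>"
  \<comment> \<open>By \<open>exp_family_mgf\<close>, \<open>p\<close> is the moment generating
    function of \<open>X - m\<close>; centring at \<open>m\<close> makes its derivative
    \<open>p'\<close> vanish at 0.\<close>
  define p where "p h = exp (b (\<theta> + h) - b \<theta> - h * m)" for h
  define p' where "p' h = (deriv b (\<theta> + h) - m) * p h" for h
  define V where "V = deriv (deriv b) \<theta>"
  have Dp: "(p has_real_derivative p' h) (at h)" for h
    unfolding p_def p'_def
    by (auto intro!: derivative_eq_intros DERIV_chain2[OF DERIV_log_partition] simp: algebra_simps)
  have Dp2: "((\<lambda>h. p (- h)) has_real_derivative - p' (- h)) (at h)" for h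
    using Dp[of "- h"] by (simp add: DERIV_mirror)
  have p0: "p 0 = 1" "p' 0 = 0"
    by (simp_all add: p_def p'_def m_def)
  have Dp': "(p' has_real_derivative V) (at 0)"
  proof -
    have "(p' has_real_derivative V * p 0 + p' 0 * (deriv b (\<theta> + 0) - m)) (at 0)"
      unfolding p'_def[abs_def] V_def
      by (rule derivative_eq_intros Dp DERIV_chain2[OF DERIV_deriv_log_partition] | simp)+
        (simp add: p'_def)
    then show ?thesis by (simp add: p0)
  qed
  have Dp'2: "((\<lambda>h. p' h - p' (- h)) has_real_derivative 2 * V) (at 0)"
  proof -
    have "((\<lambda>h. p' (- h)) has_real_derivative - V) (at 0)"
      using Dp' by (simp add: DERIV_mirror[symmetric])
    from DERIV_diff[OF Dp' this] show ?thesis by simp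
  qed
  \<comment> \<open>After one use of l'Hopital the quotient is half the difference quotient at 0 of
    \<open>p' h - p' (- h)\<close>, so the limit comes from the derivative of \<open>p'\<close> at 0
    alone.\<close>
  have lim: "((\<lambda>h. (p h + p (- h) - 2) / h\<^sup>2) \<longlongrightarrow> V) (at_right 0)"
  proof (rule lhopital_right_0)
    have "isCont p 0" "isCont (\<lambda>h. p (- h)) 0"
      using Dp Dp2 by (blast intro: DERIV_isCont)+
    then have "((\<lambda>h. p h + p (- h) - 2) \<longlongrightarrow> p 0 + p (- 0) - 2) (at 0)"
      unfolding isCont_def by (intro tendsto_intros) auto
    then show "((\<lambda>h. p h + p (- h) - 2) \<longlongrightarrow> 0) (at_right 0)"
      by (auto simp: p0 intro: filterlim_mono[OF _ order_refl at_le])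
    show "((\<lambda>h::real. h\<^sup>2) \<longlongrightarrow> 0) (at_right 0)"
      by (auto intro!: tendsto_eq_intros)
    show "\<forall>\<^sub>F x::real in at_right 0. x\<^sup>2 \<noteq> 0" "\<forall>\<^sub>F x::real in at_right 0. 2 * x \<noteq> 0"
      by (auto simp: eventually_at_filter)
    show "\<forall>\<^sub>F x in at_right 0. ((\<lambda>h. p h + p (- h) - 2) has_real_derivative p' x - p' (- x)) (at x)"
      by (intro always_eventually allI) (auto intro!: derivative_eq_intros Dp Dp2)
    show "\<forall>\<^sub>F x::real in at_right 0. ((\<lambda>h. h\<^sup>2) has_real_derivative 2 * x) (at x)"
      by (intro always_eventually allI) (auto intro!: derivative_eq_intros)
    have "((\<lambda>h. (p' h - p' (- h)) / h) \<longlongrightarrow> 2 * V) (at 0)"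
      using Dp'2 unfolding has_field_derivative_iff by (simp add: p0)
    then have "((\<lambda>h. (p' h - p' (- h)) / h / 2) \<longlongrightarrow> 2 * V / 2) (at_right 0)"
      by (intro tendsto_intros) (auto intro: filterlim_mono[OF _ order_refl at_le])
    then show "((\<lambda>h. (p' h - p' (- h)) / (2 * h)) \<longlongrightarrow> V) (at_right 0)"
      by (simp add: mult.commute)
  qed
  let ?I = "\<integral>\<^sup>+x. ennreal ((x - m)\<^sup>2) \<partial>?P"
  \<comment> \<open>Integrate the hyperbolic cosine bound at \<open>y = h * (x - m)\<close> and
    solve for the second moment.\<close>
  have bound: "?I \<le> ennreal ((p h + p (- h) - 2) / h\<^sup>2)" if "0 < h" for h
  proof -
    have "2 + ennreal (h\<^sup>2) * ?I = (\<integral>\<^sup>+x. 2 + ennreal (h\<^sup>2) * ennreal ((x - m)\<^sup>2) \<partial>?P)"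
      by (simp add: nn_integral_add nn_integral_cmult emeasure_space_1)
    also have "\<dots> \<le> (\<integral>\<^sup>+x. ennreal (exp (h * (x - m))) + ennreal (exp (- h * (x - m))) \<partial>?P)"
    proof (rule nn_integral_mono)
      fix x
      have "2 + h\<^sup>2 * (x - m)\<^sup>2 \<le> exp (h * (x - m)) + exp (- h * (x - m))"
        using exp_plus_exp_minus_ge[of "h * (x - m)"] by (simp add: power_mult_distrib)
      then have "ennreal (2 + h\<^sup>2 * (x - m)\<^sup>2) \<le> ennreal (exp (h * (x - m)) + exp (- h * (x - m)))"
        by (rule ennreal_leI)
      then show "2 + ennreal (h\<^sup>2) * ennreal ((x - m)\<^sup>2) \<le>
          ennreal (exp (h * (x - m))) + ennreal (exp (- h * (x - m)))"
        by (simp add: ennreal_plus ennreal_mult)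
    qed
    also have "\<dots> = (\<integral>\<^sup>+x. ennreal (exp (h * (x - m))) \<partial>?P) + (\<integral>\<^sup>+x. ennreal (exp (- h * (x - m))) \<partial>?P)"
      by (rule nn_integral_add) measurable
    also have "\<dots> = ennreal (p h) + ennreal (p (- h))"
      by (simp only: exp_family_mgf p_def)
    also have "\<dots> = ennreal (p h + p (- h))"
      by (simp add: p_def ennreal_plus)
    finally have le: "2 + ennreal (h\<^sup>2) * ?I \<le> ennreal (p h + p (- h))" .
    \<comment> \<open>Finiteness of the second moment is not known beforehand: an infinite value
      would contradict \<open>le\<close>, whose right-hand side is finite.\<close>
    show ?thesis
    proof (cases ?I)
      case (real r)
      have "ennreal (2 + h\<^sup>2 * r) \<le> ennreal (p h + p (- h))"
        using le real by (simp add: ennreal_plus ennreal_mult)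
      then have "2 + h\<^sup>2 * r \<le> p h + p (- h)"
        by (subst (asm) ennreal_le_iff) (simp_all add: p_def)
      then have "r \<le> (p h + p (- h) - 2) / h\<^sup>2"
        using that by (simp add: field_simps)
      then show ?thesis unfolding real by (rule ennreal_leI)
    next
      case top
      then show ?thesis using le that by (simp add: ennreal_mult_top top_unique)
    qed
  qed
  have "?I \<le> ennreal V"
    by (rule tendsto_lowerbound[OF tendsto_ennrealI[OF lim]])
       (auto simp: eventually_at_filter bound)
  then show ?thesis by (simp add: m_def V_def)
qed

text \<open>Young's inequality \<open>\<bar>y\<bar> \<le> s / 2 + y^2 / (2 * s)\<close> with
  \<open>s\<close> the square root of the second moment bound: each of the two terms contributes at
  most \<open>s / 2\<close>.\<close>

lemma exp_family_mean_abs_dev_le: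
  "(\<integral>\<^sup>+x. ennreal \<bar>x - deriv b \<theta>\<bar> \<partial>exp_family \<rho> c b \<theta>) \<le> ennreal (sqrt (deriv (deriv b) \<theta>))"
proof -
  interpret prob_space "exp_family \<rho> c b \<theta>" by (rule prob_space_exp_family)
  note [measurable_cong] = sets_exp_family
  let ?P = "exp_family \<rho> c b \<theta>" and ?m = "deriv b \<theta>"
  define s where "s = sqrt (deriv (deriv b) \<theta>)"
  have s: "0 < s" "s\<^sup>2 = deriv (deriv b) \<theta>"
    using deriv2_log_partition_pos[of \<theta>] by (auto simp: s_def)
  have "(\<integral>\<^sup>+x. ennreal \<bar>x - ?m\<bar> \<partial>?P) \<le>
      (\<integral>\<^sup>+x. ennreal (s / 2) + ennreal (1 / (2 * s)) * ennreal ((x - ?m)\<^sup>2) \<partial>?P)"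
  proof (rule nn_integral_mono)
    fix x
    have "0 \<le> (\<bar>x - ?m\<bar> - s)\<^sup>2" by simp
    then have "\<bar>x - ?m\<bar> \<le> s / 2 + 1 / (2 * s) * (x - ?m)\<^sup>2"
      using s(1) by (simp add: power2_diff field_simps power2_eq_square)
    then have "ennreal \<bar>x - ?m\<bar> \<le> ennreal (s / 2 + 1 / (2 * s) * (x - ?m)\<^sup>2)"
      by (rule ennreal_leI)
    also have "\<dots> = ennreal (s / 2) + ennreal (1 / (2 * s)) * ennreal ((x - ?m)\<^sup>2)"
      using s(1) by (subst ennreal_plus) (simp_all add: ennreal_mult'[symmetric])
    finally show "ennreal \<bar>x - ?m\<bar> \<le> ennreal (s / 2) + ennreal (1 / (2 * s)) * ennreal ((x - ?m)\<^sup>2)" .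
  qed
  also have "\<dots> = ennreal (s / 2) + ennreal (1 / (2 * s)) * (\<integral>\<^sup>+x. ennreal ((x - ?m)\<^sup>2) \<partial>?P)"
    by (simp add: nn_integral_add nn_integral_cmult emeasure_space_1)
  also have "\<dots> \<le> ennreal (s / 2) + ennreal (1 / (2 * s)) * ennreal (s\<^sup>2)"
    unfolding s(2) by (intro add_left_mono mult_left_mono exp_family_second_moment_le) simp
  also have "\<dots> = ennreal (s / 2 + 1 / (2 * s) * s\<^sup>2)"
    using s(1) by (subst ennreal_plus) (simp_all add: ennreal_mult'[symmetric])
  also have "s / 2 + 1 / (2 * s) * s\<^sup>2 = s"
    using s(1) by (simp add: power2_eq_square)
  finally show ?thesis by (simp add: s_def)
qed

text \<open>At the parameter with mean \<open>R * a\<close> the rescaled deviation equals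
  \<open>a / q\<close>, where \<open>q\<close> is the ratio in the growth conditions. For
  \<open>a \<noteq> 0\<close> this parameter runs to an infinity with the sign of \<open>a\<close>,
  so \<open>q\<close> diverges. Thus noise is negligible against means of order
  \<open>R\<close>.\<close>

lemma std_dev_at_scaled_mean_tendsto_0:
  assumes surj: "range (deriv b) = UNIV"
    and bot: "filterlim (\<lambda>\<theta>. deriv b \<theta> / sqrt (deriv (deriv b) \<theta>)) at_bot at_bot"
    and top: "filterlim (\<lambda>\<theta>. deriv b \<theta> / sqrt (deriv (deriv b) \<theta>)) at_top at_top"
  shows "((\<lambda>R. sqrt (deriv (deriv b) (inv (deriv b) (R * a))) / R) \<longlongrightarrow> 0) at_top"
proof -
  define g where "g = inv (deriv b)"
  define q where "q \<theta> = deriv b \<theta> / sqrt (deriv (deriv b) \<theta>)" for \<theta>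
  have bg: "deriv b (g y) = y" for y
    using surj by (simp add: g_def surj_f_inv_f)
  \<comment> \<open>Being inverse to a strictly increasing surjection, \<open>g\<close> is monotone
    and diverges at both ends.\<close>
  have le_g: "deriv b \<theta> \<le> y \<Longrightarrow> \<theta> \<le> g y" and g_le: "y \<le> deriv b \<theta> \<Longrightarrow> g y \<le> \<theta>" for y \<theta>
    using strict_mono_less_eq[OF strict_mono_deriv_log_partition] bg by metis+
  have g_top: "filterlim g at_top at_top"
    unfolding filterlim_at_top
    by (intro allI eventually_mono[OF eventually_ge_at_top]) (rule le_g)
  have g_bot: "filterlim g at_bot at_bot"
    unfolding filterlim_at_bot
    by (intro allI eventually_mono[OF eventually_le_at_bot]) (rule g_le)
  have inv: "((\<lambda>R. a * inverse (q (g (R * a)))) \<longlongrightarrow> 0) at_top"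
  proof -
    consider "a = 0" | "0 < a" | "a < 0" by linarith
    then have "a = 0 \<or> ((\<lambda>R. inverse (q (g (R * a)))) \<longlongrightarrow> 0) at_top"
    proof cases
      case 2
      then have "filterlim (\<lambda>R. R * a) at_top at_top"
        by (intro filterlim_at_top_mult_tendsto_pos[of "\<lambda>_. a"] filterlim_ident) auto
      from filterlim_compose[OF top filterlim_compose[OF g_top this]]
      have "((\<lambda>R. inverse (q (g (R * a)))) \<longlongrightarrow> 0) at_top"
        unfolding q_def by (rule tendsto_inverse_0_at_top)
      then show ?thesis ..
    next
      case 3
      then have "filterlim (\<lambda>R. R * - a) at_top at_top"
        by (intro filterlim_at_top_mult_tendsto_pos[of "\<lambda>_. - a"] filterlim_ident) auto
      then have "filterlim (\<lambda>R. R * a) at_bot at_top"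
        unfolding filterlim_uminus_at_bot by simp
      from filterlim_compose[OF bot filterlim_compose[OF g_bot this]]
      have "((\<lambda>R. inverse (q (g (R * a)))) \<longlongrightarrow> 0) at_top"
        unfolding q_def
        by (rule filterlim_compose[OF tendsto_inverse_0 filterlim_mono[OF _ at_bot_le_at_infinity order_refl]])
      then show ?thesis ..
    qed simp
    then show ?thesis
      by (elim disjE) (simp, rule tendsto_mult_right_zero)
  qed
  show ?thesis
  proof (cases "a = 0")
    case True
    then have "(\<lambda>R. sqrt (deriv (deriv b) (inv (deriv b) (R * a))) / R) =
        (\<lambda>R. sqrt (deriv (deriv b) (inv (deriv b) 0)) / R)"
      by simp
    then show ?thesis
      by (simp only: real_tendsto_divide_at_top[OF tendsto_const filterlim_ident])
  next
    case False
    have "\<forall>\<^sub>F R in at_top. a * inverse (q (g (R * a))) = sqrt (deriv (deriv b) (g (R * a))) / R"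
      using eventually_gt_at_top[of 0]
    proof eventually_elim
      case (elim R)
      have "a * (v / (R * a)) = v / R" for v
        using False elim by simp
      then show ?case unfolding q_def bg inverse_divide .
    qed
    from Lim_transform_eventually[OF inv this] show ?thesis by (simp add: g_def)
  qed
qed

end

section \<open>Hyperplane arrangements\<close>

lemma affine_hyperplane_eq:
  fixes H :: "'a::euclidean_space set"
  assumes "affine_hyperplane H"
  shows "\<exists>a b. a \<noteq> 0 \<and> H = {x. a \<bullet> x = b}"
proof -
  have "affine H" "aff_dim H = int DIM('a) - 1"
    using assms by (simp_all add: affine_hyperplane_def)
  then show ?thesis
    using aff_dim_eq_hyperplane[of H] by (simp add: hull_same)
qed

text \<open>The sign of \<open>s k\<close> prescribes a side of the \<open>k\<close>-th hyperplane,
  so the set is an intersection of open half-spaces. Later \<open>s k\<close> is the value of the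
  \<open>k\<close>-th affine form at a base point.\<close>

lemma convex_same_sides:
  fixes v :: "'i \<Rightarrow> 'a::euclidean_space"
  shows "convex {x. \<forall>k\<in>I. 0 < (v k \<bullet> x - t k) * s k}"
proof -
  have "{x. \<forall>k\<in>I. 0 < (v k \<bullet> x - t k) * s k} = (\<Inter>k\<in>I. {x. (s k *\<^sub>R v k) \<bullet> x > s k * t k})"
    by (auto simp: algebra_simps)
  then show ?thesis
    by (simp only: convex_INT convex_halfspace_gt)
qed

text \<open>A connected set that misses a hyperplane cannot change sides, by the intermediate value
  theorem. Conversely the cell of \<open>x0\<close> is convex, misses all hyperplanes and meets
  \<open>C\<close>, so maximality of components puts it inside \<open>C\<close>.\<close>

lemma component_hyperplane_arrangement:
  fixes v :: "'i \<Rightarrow> 'a::euclidean_space"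
  assumes C: "C \<in> components (UNIV - (\<Union>k\<in>I. {x. v k \<bullet> x = t k}))" and x0: "x0 \<in> C"
  shows "C = {x. \<forall>k\<in>I. 0 < (v k \<bullet> x - t k) * (v k \<bullet> x0 - t k)}" (is "C = ?E")
proof
  have conn: "connected C" and sub: "C \<subseteq> UNIV - (\<Union>k\<in>I. {x. v k \<bullet> x = t k})"
    using C by (auto simp: in_components_connected dest: in_components_subset)
  show "C \<subseteq> ?E"
  proof (intro subsetI CollectI ballI)
    fix x k assume x: "x \<in> C" and k: "k \<in> I"
    show "0 < (v k \<bullet> x - t k) * (v k \<bullet> x0 - t k)"
    proof (rule ccontr)
      assume "\<not> 0 < (v k \<bullet> x - t k) * (v k \<bullet> x0 - t k)"
      then have "v k \<bullet> x \<le> t k \<and> t k \<le> v k \<bullet> x0 \<or> v k \<bullet> x0 \<le> t k \<and> t k \<le> v k \<bullet> x"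
        by (auto simp: not_less mult_le_0_iff)
      then obtain z where "z \<in> C" "v k \<bullet> z = t k"
        using connected_ivt_hyperplane[OF conn] x x0 by blast
      then show False using sub k by blast
    qed
  qed
  have "v k \<bullet> x0 \<noteq> t k" if "k \<in> I" for k
    using x0 sub that by blast
  then have "x0 \<in> ?E"
    by (simp flip: power2_eq_square)
  then have "C \<inter> ?E \<noteq> {}"
    using x0 by blast
  moreover have "?E \<subseteq> UNIV - (\<Union>k\<in>I. {x. v k \<bullet> x = t k})"
    by fastforce
  ultimately show "?E \<subseteq> C"
    by (intro components_maximal[OF C convex_connected[OF convex_same_sides]])
qed

lemma convex_component_hyperplane_arrangement:
  fixes v :: "'i \<Rightarrow> 'a::euclidean_space"
  assumes C: "C \<in> components (UNIV - (\<Union>k\<in>I. {x. v k \<bullet> x = t k}))"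
  shows "convex C"
proof -
  obtain x0 where x0: "x0 \<in> C"
    using in_components_nonempty[OF C] by blast
  show ?thesis
    by (subst component_hyperplane_arrangement[OF C x0]) (rule convex_same_sides)
qed

text \<open>Let \<open>g\<close> be the projection along \<open>u\<close>; it kills only multiples
  of \<open>u\<close>. The finitely many hyperplanes orthogonal to the vectors \<open>g f\<close>
  form a null set. Take \<open>x\<close> outside it and project: since \<open>g\<close> is
  self-adjoint, \<open>f \<bullet> w = g f \<bullet> x\<close>.\<close>

lemma generic_orthogonal_vector:
  fixes u :: "'a::euclidean_space"
  assumes "finite F" and "\<And>f c. f \<in> F \<Longrightarrow> f \<noteq> c *\<^sub>R u"
  shows "\<exists>w. u \<bullet> w = 0 \<and> (\<forall>f\<in>F. f \<bullet> w \<noteq> 0)"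
proof -
  define g where "g f = f - ((f \<bullet> u) / (u \<bullet> u)) *\<^sub>R u" for f
  have "negligible (\<Union>f\<in>F. {x. g f \<bullet> x = 0})"
  proof (intro negligible_Union finite_imageI assms(1))
    fix T assume "T \<in> (\<lambda>f. {x. g f \<bullet> x = 0}) ` F"
    then obtain f where f: "f \<in> F" "T = {x. g f \<bullet> x = 0}" by blast
    have "g f \<noteq> 0" using assms(2)[OF f(1)] by (simp add: g_def)
    then show "negligible T" unfolding f(2) by (blast intro: negligible_hyperplane)
  qed
  then have "(\<Union>f\<in>F. {x. g f \<bullet> x = 0}) \<noteq> UNIV"
    using non_negligible_UNIV by fastforce
  then obtain x where x: "\<And>f. f \<in> F \<Longrightarrow> g f \<bullet> x \<noteq> 0"
    by blast
  define w where "w = x - ((x \<bullet> u) / (u \<bullet> u)) *\<^sub>R u"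
  have "u \<bullet> w = 0"
    \<comment> \<open>For \<open>u = 0\<close> the quotient is 0 by the convention for division, and
      \<open>w = x\<close>.\<close>
    by (cases "u = 0") (auto simp: w_def inner_diff_right inner_commute[of x u])
  moreover have "f \<bullet> w = g f \<bullet> x" for f
    by (simp add: w_def g_def inner_diff_right inner_diff_left inner_commute[of x u])
  ultimately show ?thesis using x by metis
qed

section \<open>Regions far out along a generic ray\<close>

lemma eventually_less_mult_at_top:
  fixes A B :: real
  assumes "0 < A"
  shows "\<forall>\<^sub>F x in at_top. B < A * x"
  using eventually_gt_at_top[of "B / A"]
  by eventually_elim (simp add: pos_divide_less_eq[OF assms] mult.commute)

text \<open>Far out along a direction \<open>w\<close> that is transversal to all hyperplanes not parallel to the given
  one, only the parallel hyperplanes remain in sight.\<close>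

lemma ex_component_containing_ray:
  fixes v :: "'i \<Rightarrow> 'a::euclidean_space"
  assumes fin: "finite I" and nz: "\<And>k. k \<in> I \<Longrightarrow> v k \<noteq> 0"
    and k0: "k0 \<in> I" "{x. v k0 \<bullet> x = t k0} = {x. u \<bullet> x = t0}"
    and u: "u \<noteq> 0" "u \<bullet> w = 0"
    and gen: "\<And>k. k \<in> I \<Longrightarrow> (\<exists>c. v k = c *\<^sub>R u) \<or> v k \<bullet> w \<noteq> 0"
  obtains C \<tau> where "C \<in> components (UNIV - (\<Union>k\<in>I. {x. v k \<bullet> x = t k}))"
    and "C \<subseteq> {x. t0 \<le> u \<bullet> x}" and "\<forall>\<^sub>F R in at_top. R *\<^sub>R w + \<tau> *\<^sub>R u \<in> C"
proof -
  let ?X = "UNIV - (\<Union>k\<in>I. {x. v k \<bullet> x = t k})"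
  \<comment> \<open>The sign of \<open>e k\<close> is the side of the \<open>k\<close>-th hyperplane
    on which the far points lie: \<open>w\<close> decides it for transversal hyperplanes,
    \<open>u\<close> for parallel ones.\<close>
  define e where "e k = (if v k \<bullet> w \<noteq> 0 then v k \<bullet> w else v k \<bullet> u)" for k
  \<comment> \<open>The order of choices matters: first \<open>\<tau>\<close> moves past all
    parallel hyperplanes, uniformly in \<open>R\<close>; then \<open>R\<close> outweighs this fixed
    shift at the transversal ones.\<close>
  have "\<forall>\<^sub>F \<tau> in at_top. \<forall>k\<in>I. v k \<bullet> w = 0 \<longrightarrow> e k * t k < (v k \<bullet> u)\<^sup>2 * \<tau>"
  proof (rule eventually_ball_finite[OF fin], rule ballI)
    fix k assume k: "k \<in> I"
    show "\<forall>\<^sub>F \<tau> in at_top. v k \<bullet> w = 0 \<longrightarrow> e k * t k < (v k \<bullet> u)\<^sup>2 * \<tau>"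
    proof (cases "v k \<bullet> w = 0")
      case True
      then obtain c where "v k = c *\<^sub>R u" using gen[OF k] by blast
      then have "0 < (v k \<bullet> u)\<^sup>2" using nz[OF k] u by auto
      from eventually_less_mult_at_top[OF this] show ?thesis by simp
    qed simp
  qed
  moreover have "\<forall>\<^sub>F \<tau> in at_top. t0 < (u \<bullet> u) * \<tau>"
    using u by (intro eventually_less_mult_at_top) simp
  ultimately have "\<exists>\<tau>. (\<forall>k\<in>I. v k \<bullet> w = 0 \<longrightarrow> e k * t k < (v k \<bullet> u)\<^sup>2 * \<tau>) \<and> t0 < (u \<bullet> u) * \<tau>"
    by (intro eventually_happens'[OF trivial_limit_at_top_linorder] eventually_conj)
  then obtain \<tau> where \<tau>: "\<And>k. k \<in> I \<Longrightarrow> v k \<bullet> w = 0 \<Longrightarrow> e k * t k < (v k \<bullet> u)\<^sup>2 * \<tau>"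
      "t0 < (u \<bullet> u) * \<tau>"
    by blast
  define x where "x R = R *\<^sub>R w + \<tau> *\<^sub>R u" for R
  have vx: "v k \<bullet> x R = R * (v k \<bullet> w) + \<tau> * (v k \<bullet> u)" for k R
    by (simp add: x_def inner_add_right)
  have "\<forall>\<^sub>F R in at_top. \<forall>k\<in>I. 0 < e k * (v k \<bullet> x R - t k)"
  proof (rule eventually_ball_finite[OF fin], rule ballI)
    fix k assume k: "k \<in> I"
    show "\<forall>\<^sub>F R in at_top. 0 < e k * (v k \<bullet> x R - t k)"
    proof (cases "v k \<bullet> w = 0")
      case True
      then have "0 < e k * (v k \<bullet> x R - t k)" for R
        using \<tau>(1)[OF k True] True by (simp add: vx e_def algebra_simps power2_eq_square)
      then show ?thesis by simp
    next
      case False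
      then have "0 < (v k \<bullet> w)\<^sup>2" by simp
      from eventually_less_mult_at_top[OF this, of "(v k \<bullet> w) * (t k - \<tau> * (v k \<bullet> u))"]
      show ?thesis
        by (rule eventually_mono) (use False in \<open>simp add: vx e_def algebra_simps power2_eq_square\<close>)
    qed
  qed
  then obtain R0 where R0: "\<And>R k. R0 \<le> R \<Longrightarrow> k \<in> I \<Longrightarrow> 0 < e k * (v k \<bullet> x R - t k)"
    unfolding eventually_at_top_linorder by blast
  define C where "C = connected_component_set ?X (x R0)"
  have xX: "x R0 \<in> ?X"
    using R0[of R0] by fastforce
  have C: "C \<in> components ?X" "x R0 \<in> C"
    using componentsI[OF xX] connected_component_refl[OF xX] unfolding C_def mem_Collect_eq .
  show thesis
  proof
    show "C \<in> components ?X" by fact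
    \<comment> \<open>The hyperplane \<open>u \<bullet> x = t0\<close> is the \<open>k0\<close>-th
      one, which the connected set \<open>C\<close> misses, and \<open>x R0\<close> lies beyond
      it.\<close>
    show "C \<subseteq> {x. t0 \<le> u \<bullet> x}"
    proof (rule ccontr)
      assume "\<not> C \<subseteq> {x. t0 \<le> u \<bullet> x}"
      then obtain y where "y \<in> C" "u \<bullet> y \<le> t0" by force
      moreover have "t0 \<le> u \<bullet> x R0"
        using \<tau>(2) u by (simp add: x_def inner_add_right mult.commute)
      ultimately obtain z where "z \<in> C" "u \<bullet> z = t0"
        using connected_ivt_hyperplane[OF in_components_connected[OF C(1)]] C(2) by blast
      then show False
        using in_components_subset[OF C(1)] k0 by blast
    qed
    have "x R \<in> C" if "R0 \<le> R" for R
    proof -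
      have "0 < (v k \<bullet> x R - t k) * (v k \<bullet> x R0 - t k)" if "k \<in> I" for k
        using R0[OF \<open>R0 \<le> R\<close> that] R0[OF order_refl that] by (auto simp: zero_less_mult_iff)
      then show ?thesis
        by (subst component_hyperplane_arrangement[OF C]) simp
    qed
    then show "\<forall>\<^sub>F R in at_top. R *\<^sub>R w + \<tau> *\<^sub>R u \<in> C"
      unfolding x_def eventually_at_top_linorder by blast
  qed
qed

section \<open>Projection onto such a region\<close>

text \<open>The projection is at most as far from
  \<open>R *\<^sub>R (w - \<epsilon> *\<^sub>R u)\<close> as the known point
  \<open>R *\<^sub>R w + \<tau> *\<^sub>R u\<close>. On expanding both squares the terms quadratic
  in \<open>R\<close> cancel, and the half-space condition bounds the cross term. What remains is
  linear in \<open>R\<close>.\<close>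

lemma closest_point_halfspace_bound:
  fixes u w :: "'a::euclidean_space"
  assumes "closed S" and S: "S \<subseteq> {x. t0 \<le> u \<bullet> x}" and w: "u \<bullet> w = 0"
    and mem: "R *\<^sub>R w + \<tau> *\<^sub>R u \<in> S" and "0 \<le> R * \<epsilon>"
  shows "(norm (closest_point S (R *\<^sub>R (w - \<epsilon> *\<^sub>R u)) - R *\<^sub>R w))\<^sup>2 \<le>
    2 * (R * \<epsilon>) * (\<tau> * (u \<bullet> u) - t0) + \<tau>\<^sup>2 * (u \<bullet> u)"
proof -
  let ?y = "R *\<^sub>R (w - \<epsilon> *\<^sub>R u)" and ?z = "R *\<^sub>R w + \<tau> *\<^sub>R u"
  define p where "p = closest_point S ?y"
  have "p \<in> S"
    using closest_point_exists(1)[OF \<open>closed S\<close>] mem by (auto simp: p_def)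
  then have up: "t0 \<le> u \<bullet> (p - R *\<^sub>R w)"
    using S w by (auto simp: inner_diff_right)
  have "norm (?y - p) \<le> norm (?y - ?z)"
    using closest_point_le[OF \<open>closed S\<close> mem, of ?y] by (simp add: p_def dist_norm)
  then have "(norm (?y - p))\<^sup>2 \<le> (norm (?y - ?z))\<^sup>2"
    by (rule power_mono) simp
  moreover have "?y - p = - ((p - R *\<^sub>R w) + (R * \<epsilon>) *\<^sub>R u)" "?y - ?z = - ((\<tau> + R * \<epsilon>) *\<^sub>R u)"
    by (simp_all add: algebra_simps)
  ultimately have "(norm ((p - R *\<^sub>R w) + (R * \<epsilon>) *\<^sub>R u))\<^sup>2 \<le> (norm ((\<tau> + R * \<epsilon>) *\<^sub>R u))\<^sup>2"
    by (simp only: norm_minus_cancel)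
  moreover have "(norm (q + s *\<^sub>R u))\<^sup>2 = (norm q)\<^sup>2 + 2 * s * (u \<bullet> q) + s\<^sup>2 * (u \<bullet> u)" for q s
    unfolding power2_norm_eq_inner
    by (simp add: inner_add_left inner_add_right inner_commute[of q u] power2_eq_square distrib_left)
  moreover have "(norm ((\<tau> + R * \<epsilon>) *\<^sub>R u))\<^sup>2 = \<tau>\<^sup>2 * (u \<bullet> u) + 2 * (R * \<epsilon>) * (\<tau> * (u \<bullet> u)) + (R * \<epsilon>)\<^sup>2 * (u \<bullet> u)"
    unfolding power2_norm_eq_inner by (simp add: power2_eq_square distrib_left distrib_right)
  ultimately have "(norm (p - R *\<^sub>R w))\<^sup>2 + 2 * (R * \<epsilon>) * (u \<bullet> (p - R *\<^sub>R w)) \<le>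
      \<tau>\<^sup>2 * (u \<bullet> u) + 2 * (R * \<epsilon>) * (\<tau> * (u \<bullet> u))"
    by simp
  moreover have "2 * (R * \<epsilon>) * t0 \<le> 2 * (R * \<epsilon>) * (u \<bullet> (p - R *\<^sub>R w))"
    using up \<open>0 \<le> R * \<epsilon>\<close> by (intro mult_left_mono) auto
  ultimately show ?thesis
    by (simp add: p_def right_diff_distrib)
qed

text \<open>The squared distance is at most \<open>A * R + B\<close>, so the distance is of order
  \<open>sqrt R\<close> and disappears after division by \<open>R\<close>.\<close>

lemma closest_point_scaled_tendsto:
  fixes u w :: "'a::euclidean_space"
  assumes "closed S" and S: "S \<subseteq> {x. t0 \<le> u \<bullet> x}" and w: "u \<bullet> w = 0"
    and mem: "\<forall>\<^sub>F R in at_top. R *\<^sub>R w + \<tau> *\<^sub>R u \<in> S" and "0 \<le> \<epsilon>"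
  shows "((\<lambda>R. norm (closest_point S (R *\<^sub>R (w - \<epsilon> *\<^sub>R u)) - R *\<^sub>R w) / R) \<longlongrightarrow> 0) at_top"
proof (rule tendsto_sandwich[OF _ _ tendsto_const])
  define A where "A = 2 * \<epsilon> * (\<tau> * (u \<bullet> u) - t0)"
  define B where "B = \<tau>\<^sup>2 * (u \<bullet> u)"
  let ?q = "\<lambda>R. norm (closest_point S (R *\<^sub>R (w - \<epsilon> *\<^sub>R u)) - R *\<^sub>R w)"
  have pos: "\<forall>\<^sub>F R::real in at_top. 0 < R" by (rule eventually_gt_at_top)
  show "\<forall>\<^sub>F R in at_top. 0 \<le> ?q R / R"
    using pos by eventually_elim simp
  show "\<forall>\<^sub>F R in at_top. ?q R / R \<le> sqrt (A / R + B / R / R)"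
    using pos mem
  proof eventually_elim
    case (elim R)
    have "(?q R)\<^sup>2 \<le> A * R + B"
      using closest_point_halfspace_bound[OF \<open>closed S\<close> S w elim(2), of \<epsilon>] elim(1) \<open>0 \<le> \<epsilon>\<close>
      by (simp add: A_def B_def mult_ac)
    then have "(?q R)\<^sup>2 / R\<^sup>2 \<le> (A * R + B) / R\<^sup>2"
      by (rule divide_right_mono) simp
    then have "(?q R / R)\<^sup>2 \<le> A / R + B / R / R"
      using elim(1) by (simp add: power_divide add_divide_distrib power2_eq_square)
    then show ?case by (rule real_le_rsqrt)
  qed
  have "((\<lambda>R. sqrt (A / R + B / R / R)) \<longlongrightarrow> sqrt (0 + 0)) at_top"
    by (intro tendsto_real_sqrt tendsto_add real_tendsto_divide_at_top[OF _ filterlim_ident])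
       (auto intro: real_tendsto_divide_at_top[OF tendsto_const filterlim_ident])
  then show "((\<lambda>R. sqrt (A / R + B / R / R)) \<longlongrightarrow> 0) at_top" by simp
qed

section \<open>Truthfulness and large means\<close>

lemma vec_lambda_measurable_PiM:
  fixes M :: "'n::finite \<Rightarrow> real measure"
  assumes [measurable_cong]: "\<And>i. sets (M i) = sets borel"
  shows "(\<lambda>X. \<chi> j. X j) \<in> borel_measurable (Pi\<^sub>M UNIV M)"
proof (rule borel_measurable_euclidean_space[THEN iffD2], rule ballI)
  fix b :: "real^'n" assume "b \<in> Basis"
  then obtain i where "b = axis i 1"
    by (auto simp: Basis_vec_def)
  moreover have "(\<lambda>X. X i) \<in> borel_measurable (Pi\<^sub>M UNIV M)"
    using measurable_component_singleton[of i UNIV M] by measurable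
  ultimately show "(\<lambda>X. (\<chi> j. X j) \<bullet> b) \<in> borel_measurable (Pi\<^sub>M UNIV M)"
    by (simp add: inner_axis)
qed

text \<open>Projection onto a closed convex set is 1-Lipschitz. The Euclidean norm is then replaced
  by the sum of absolute values, because the expectation of the latter splits over the
  coordinates.\<close>

lemma sum_closest_point_deviation:
  fixes S :: "(real^'n) set" and U :: "real \<Rightarrow> real"
  assumes S: "convex S" "closed S" "S \<noteq> {}" and U: "\<And>x y. \<bar>U x - U y\<bar> \<le> \<bar>x - y\<bar>"
  shows "\<bar>(\<Sum>i\<in>UNIV. U (closest_point S x $ i)) - (\<Sum>i\<in>UNIV. U (closest_point S y $ i))\<bar> \<le>
    real CARD('n) * (\<Sum>i\<in>UNIV. \<bar>x $ i - y $ i\<bar>)"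
proof -
  have "\<bar>(\<Sum>i\<in>UNIV. U (closest_point S x $ i)) - (\<Sum>i\<in>UNIV. U (closest_point S y $ i))\<bar> \<le>
      (\<Sum>i\<in>UNIV. \<bar>U (closest_point S x $ i) - U (closest_point S y $ i)\<bar>)"
    unfolding sum_subtractf[symmetric] by (rule sum_abs)
  also have "\<dots> \<le> (\<Sum>i::'n\<in>UNIV. (\<Sum>i\<in>UNIV. \<bar>x $ i - y $ i\<bar>))"
  proof (rule sum_mono)
    fix i
    have "\<bar>U (closest_point S x $ i) - U (closest_point S y $ i)\<bar> \<le>
        \<bar>(closest_point S x - closest_point S y) $ i\<bar>"
      using U by simp
    also have "\<dots> \<le> norm (closest_point S x - closest_point S y)"
      by (rule component_le_norm_cart)
    also have "\<dots> \<le> norm (x - y)"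
      using closest_point_lipschitz[OF S] by (simp add: dist_norm)
    also have "\<dots> \<le> (\<Sum>i\<in>UNIV. \<bar>x $ i - y $ i\<bar>)"
      using norm_le_l1_cart[of "x - y"] by simp
    finally show "\<bar>U (closest_point S x $ i) - U (closest_point S y $ i)\<bar> \<le>
      (\<Sum>i\<in>UNIV. \<bar>x $ i - y $ i\<bar>)" .
  qed
  finally show ?thesis by simp
qed

lemma Util_nonneg:
  assumes "\<And>x. 0 \<le> U x"
  shows "Util P \<theta> U S = enn2ereal (\<integral>\<^sup>+X. ennreal (\<Sum>i\<in>UNIV. U (closest_point (closure S) (\<chi> j. X j) $ i))
    \<partial>Pi\<^sub>M UNIV (\<lambda>i. P (\<theta> $ i)))"
proof -
  have "ennreal (- (\<Sum>i\<in>UNIV. U (closest_point (closure S) (\<chi> j. X j) $ i))) = 0" for X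
    using assms by (simp add: ennreal_neg sum_nonneg)
  then show ?thesis
    by (simp add: Util_def ext_expectation_def zero_ennreal.rep_eq)
qed

context
  fixes \<rho> :: "real measure" and c b :: "real \<Rightarrow> real"
  assumes reg: "regular_exp_family \<rho> c b"
begin

text \<open>Replacing the observation by its mean changes the utility of a report by at most
  \<open>g\<close>, whose expectation is at most \<open>n * D\<close>. This is paid once for
  \<open>S\<close> and once for \<open>S'\<close>; projection onto \<open>S'\<close> fixes the
  mean.\<close>

lemma truthful_imp_projected_mean_le:
  fixes \<theta> :: "real^'n" and \<S> :: "(real^'n) set set"
  assumes truthful: "truthful (exp_family \<rho> c b) b \<S>"
    and U: "mono U" "convex_on UNIV U" "\<And>x. 0 \<le> U x" "\<And>x y. \<bar>U x - U y\<bar> \<le> \<bar>x - y\<bar>"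
    and S: "S \<in> \<S>" "convex (closure S)" "S \<noteq> {}"
    and S': "S' \<in> \<S>" "convex (closure S')" "(\<chi> i. deriv b (\<theta> $ i)) \<in> S'"
  shows "(\<Sum>i\<in>UNIV. U (closest_point (closure S) (\<chi> i. deriv b (\<theta> $ i)) $ i)) \<le>
    (\<Sum>i\<in>UNIV. U (deriv b (\<theta> $ i))) +
      2 * real CARD('n) * (\<Sum>i\<in>UNIV. sqrt (deriv (deriv b) (\<theta> $ i)))"
proof -
  define \<mu> where "\<mu> = (\<chi> i. deriv b (\<theta> $ i))"
  define M where "M = (\<lambda>i. exp_family \<rho> c b (\<theta> $ i))"
  let ?PM = "Pi\<^sub>M UNIV M"
  define f where "f S x = (\<Sum>i\<in>UNIV. U (closest_point (closure S) x $ i))" for S and x :: "real^'n"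
  define n where "n = real CARD('n)"
  define D where "D = (\<Sum>i\<in>UNIV. sqrt (deriv (deriv b) (\<theta> $ i)))"
  define g where "g X = ennreal n * (\<Sum>i\<in>UNIV. ennreal \<bar>X i - \<mu> $ i\<bar>)" for X :: "'n \<Rightarrow> real"
  have M_sets [measurable_cong]: "sets (M i) = sets borel" for i
    by (simp add: M_def sets_exp_family[OF reg])
  have M_prob: "prob_space (M i)" for i
    by (simp add: M_def prob_space_exp_family[OF reg])
  interpret prob_space ?PM
    by (rule prob_space_PiM) (rule M_prob)
  have n: "0 \<le> n"
    by (simp add: n_def)
  have D: "0 \<le> D"
    unfolding D_def
    by (intro sum_nonneg real_sqrt_ge_zero less_imp_le[OF deriv2_log_partition_pos[OF reg]])
  have f_nonneg: "0 \<le> f T x" for T x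
    using U(3) by (simp add: f_def sum_nonneg)
  have dev: "(\<integral>\<^sup>+X. ennreal \<bar>X i - \<mu> $ i\<bar> \<partial>?PM) \<le> ennreal (sqrt (deriv (deriv b) (\<theta> $ i)))" for i
  proof -
    have "(\<integral>\<^sup>+X. ennreal \<bar>X i - \<mu> $ i\<bar> \<partial>?PM) = (\<integral>\<^sup>+x. ennreal \<bar>x - \<mu> $ i\<bar> \<partial>distr ?PM (M i) (\<lambda>X. X i))"
    proof (rule nn_integral_distr[symmetric])
      show "(\<lambda>X. X i) \<in> measurable ?PM (M i)"
        by (rule measurable_component_singleton) simp
      have "(\<lambda>x. ennreal \<bar>x - \<mu> $ i\<bar>) \<in> borel_measurable (M i)"
        by measurable
      then show "(\<lambda>x. ennreal \<bar>x - \<mu> $ i\<bar>) \<in> borel_measurable (distr ?PM (M i) (\<lambda>X. X i))"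
        by simp
    qed
    also have "distr ?PM (M i) (\<lambda>X. X i) = M i"
      by (rule distr_PiM_component) (simp_all add: M_prob)
    also have "(\<integral>\<^sup>+x. ennreal \<bar>x - \<mu> $ i\<bar> \<partial>M i) \<le> ennreal (sqrt (deriv (deriv b) (\<theta> $ i)))"
      unfolding M_def \<mu>_def using exp_family_mean_abs_dev_le[OF reg] by simp
    finally show ?thesis .
  qed
  have coord [measurable]: "(\<lambda>X. X i) \<in> borel_measurable ?PM" for i
    using measurable_component_singleton[of i UNIV M] by measurable
  have [measurable]: "g \<in> borel_measurable ?PM"
    unfolding g_def by measurable
  have int_g: "(\<integral>\<^sup>+X. g X \<partial>?PM) \<le> ennreal (n * D)"
  proof -
    have "(\<integral>\<^sup>+X. g X \<partial>?PM) = ennreal n * (\<Sum>i\<in>UNIV. \<integral>\<^sup>+X. ennreal \<bar>X i - \<mu> $ i\<bar> \<partial>?PM)"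
      unfolding g_def by (simp add: nn_integral_cmult nn_integral_sum del: sum_ennreal)
    also have "\<dots> \<le> ennreal n * (\<Sum>i\<in>UNIV. ennreal (sqrt (deriv (deriv b) (\<theta> $ i))))"
      by (intro mult_left_mono sum_mono dev) simp
    also have "\<dots> = ennreal (n * D)"
      using n deriv2_log_partition_pos[OF reg]
      by (simp add: D_def ennreal_mult' sum_ennreal less_imp_le)
    finally show ?thesis .
  qed
  have g_eq: "g X = ennreal (n * (\<Sum>i\<in>UNIV. \<bar>X i - \<mu> $ i\<bar>))" for X
    using n by (simp add: g_def ennreal_mult' sum_ennreal sum_nonneg)
  have f_dev: "\<bar>f T (\<chi> j. X j) - f T \<mu>\<bar> \<le> n * (\<Sum>i\<in>UNIV. \<bar>X i - \<mu> $ i\<bar>)"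
    if "convex (closure T)" "T \<noteq> {}" for T X
    using sum_closest_point_deviation[of "closure T" U "\<chi> j. X j" \<mu>] that U(4)
    by (simp add: f_def n_def)
  \<comment> \<open>The disjunction covers both directions: from the mean to the observation for
    \<open>S\<close>, and back for \<open>S'\<close>.\<close>
  have f_le: "ennreal (f T x) \<le> ennreal (f T y) + g X"
    if "convex (closure T)" "T \<noteq> {}" "x = (\<chi> j. X j) \<and> y = \<mu> \<or> x = \<mu> \<and> y = (\<chi> j. X j)" for T X x y
  proof -
    have "f T x \<le> f T y + n * (\<Sum>i\<in>UNIV. \<bar>X i - \<mu> $ i\<bar>)"
      using f_dev[OF that(1,2), of X] that(3) by (auto simp: abs_le_iff)
    then have "ennreal (f T x) \<le> ennreal (f T y + n * (\<Sum>i\<in>UNIV. \<bar>X i - \<mu> $ i\<bar>))"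
      by (rule ennreal_leI)
    then show ?thesis
      using n f_nonneg by (simp add: g_eq ennreal_plus sum_nonneg)
  qed
  let ?I = "\<lambda>T. \<integral>\<^sup>+X. ennreal (f T (\<chi> j. X j)) \<partial>?PM"
  have \<mu>_S': "closest_point (closure S') \<mu> = \<mu>"
    using S'(3) closure_subset by (intro closest_point_self) (auto simp: \<mu>_def)
  \<comment> \<open>Pass from the mean to the observation on \<open>S\<close>, compare
    \<open>S\<close> with \<open>S'\<close> by truthfulness, and return to the mean on
    \<open>S'\<close>.\<close>
  have "ennreal (f S \<mu>) = (\<integral>\<^sup>+X. ennreal (f S \<mu>) \<partial>?PM)"
    by (simp add: emeasure_space_1)
  also have "\<dots> \<le> (\<integral>\<^sup>+X. ennreal (f S (\<chi> j. X j)) + g X \<partial>?PM)"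
    using S by (intro nn_integral_mono f_le) auto
  also have "\<dots> = ?I S + (\<integral>\<^sup>+X. g X \<partial>?PM)"
  proof (rule nn_integral_add)
    have "continuous_on UNIV U"
      using convex_on_continuous[OF _ U(2)] by simp
    then have [measurable]: "U \<in> borel_measurable borel"
      by (rule borel_measurable_continuous_onI)
    have "continuous_on UNIV (closest_point (closure S))"
      using S by (intro continuous_on_closest_point) auto
    then have [measurable]: "closest_point (closure S) \<in> borel_measurable borel"
      by (rule borel_measurable_continuous_onI)
    have [measurable]: "(\<lambda>x::real^'n. x $ i) \<in> borel_measurable borel" for i
      by (intro borel_measurable_continuous_onI continuous_intros)
    note [measurable] = vec_lambda_measurable_PiM[of M, OF M_sets]
    show "(\<lambda>X. ennreal (f S (\<chi> j. X j))) \<in> borel_measurable ?PM"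
      unfolding f_def by measurable
  qed measurable
  also have "\<dots> \<le> ?I S' + (\<integral>\<^sup>+X. g X \<partial>?PM)"
  proof (rule add_right_mono)
    have "Util (exp_family \<rho> c b) \<theta> U S \<le> Util (exp_family \<rho> c b) \<theta> U S'"
      using truthful U S(1) S'(1,3) unfolding truthful_def by blast
    then show "?I S \<le> ?I S'"
      using U(3) by (simp add: Util_nonneg f_def M_def less_eq_ennreal.rep_eq)
  qed
  also have "\<dots> \<le> (\<integral>\<^sup>+X. ennreal (f S' \<mu>) + g X \<partial>?PM) + (\<integral>\<^sup>+X. g X \<partial>?PM)"
    using S' by (intro add_right_mono nn_integral_mono f_le) auto
  also have "\<dots> = ennreal (f S' \<mu>) + (\<integral>\<^sup>+X. g X \<partial>?PM) + (\<integral>\<^sup>+X. g X \<partial>?PM)"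
    by (subst nn_integral_add) (simp_all add: emeasure_space_1)
  also have "\<dots> \<le> ennreal (f S' \<mu>) + ennreal (n * D) + ennreal (n * D)"
    by (intro add_mono int_g) simp
  also have "\<dots> = ennreal (f S' \<mu> + 2 * n * D)"
    using n D f_nonneg by (simp add: ennreal_plus[symmetric] del: ennreal_plus)
  finally have "f S \<mu> \<le> f S' \<mu> + 2 * n * D"
    using n D f_nonneg by (subst (asm) ennreal_le_iff) simp_all
  then show ?thesis
    by (simp add: f_def \<mu>_S') (simp add: \<mu>_def n_def D_def)
qed

end

section \<open>Hinge utilities and the limit of large means\<close>

lemma hinge_mono_convex_lipschitz:
  fixes s :: real
  defines "U \<equiv> \<lambda>x. max 0 (x - s)"
  shows "mono U" "convex_on UNIV U" "0 \<le> U x" "\<bar>U x - U y\<bar> \<le> \<bar>x - y\<bar>"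
proof -
  show "mono U" by (auto simp: U_def mono_def)
  show "convex_on UNIV U"
  proof (rule convex_onI)
    fix t x y :: real
    assume t: "0 < t" "t < 1"
    have "(1 - t) * (x - s) \<le> (1 - t) * max 0 (x - s)" "t * (y - s) \<le> t * max 0 (y - s)"
      "0 \<le> (1 - t) * max 0 (x - s)" "0 \<le> t * max 0 (y - s)"
      using t by (auto intro!: mult_left_mono mult_nonneg_nonneg)
    moreover have "(1 - t) * x + t * y - s = (1 - t) * (x - s) + t * (y - s)"
      by (simp add: algebra_simps)
    ultimately show "U ((1 - t) *\<^sub>R x + t *\<^sub>R y) \<le> (1 - t) * U x + t * U y"
      by (simp add: U_def)
  qed simp
qed (auto simp: U_def)

text \<open>Apply \<open>truthful_imp_projected_mean_le\<close> at the mean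
  \<open>R *\<^sub>R (w - \<epsilon> *\<^sub>R u)\<close> with hinge threshold \<open>R * s\<close>
  and divide by \<open>R\<close>. Noise and projection error vanish as \<open>R\<close> grows. For
  all \<open>s\<close> together the conclusion is weak submajorization of \<open>w\<close> by
  \<open>w - \<epsilon> *\<^sub>R u\<close>.\<close>

lemma truthful_imp_weak_majorization:
  fixes \<S> :: "(real^'n) set set" and u w :: "real^'n"
  assumes reg: "regular_exp_family \<rho> c b"
    and surj: "range (deriv b) = UNIV"
    and bot: "filterlim (\<lambda>\<theta>. deriv b \<theta> / sqrt (deriv (deriv b) \<theta>)) at_bot at_bot"
    and top: "filterlim (\<lambda>\<theta>. deriv b \<theta> / sqrt (deriv (deriv b) \<theta>)) at_top at_top"
    and truthful: "truthful (exp_family \<rho> c b) b \<S>"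
    and cover: "\<Union>\<S> = UNIV" and conv: "\<And>S. S \<in> \<S> \<Longrightarrow> convex (closure S)"
    and S: "S \<in> \<S>" "closure S \<subseteq> {x. t0 \<le> u \<bullet> x}" "\<forall>\<^sub>F R in at_top. R *\<^sub>R w + \<tau> *\<^sub>R u \<in> S"
    and w: "u \<bullet> w = 0" and \<epsilon>: "0 \<le> \<epsilon>"
  shows "(\<Sum>i\<in>UNIV. max 0 (w $ i - s)) \<le> (\<Sum>i\<in>UNIV. max 0 (w $ i - \<epsilon> * u $ i - s))"
proof -
  define n where "n = real CARD('n)"
  define a where "a = w - \<epsilon> *\<^sub>R u"
  define \<sigma> where "\<sigma> R i = sqrt (deriv (deriv b) (inv (deriv b) (R * a $ i)))" for R i
  define q where "q R = norm (closest_point (closure S) (R *\<^sub>R a) - R *\<^sub>R w)" for R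
  have "((\<lambda>R. (\<Sum>i\<in>UNIV. max 0 (a $ i - s)) + 2 * n * (\<Sum>i\<in>UNIV. \<sigma> R i / R) + n * (q R / R)) \<longlongrightarrow>
      (\<Sum>i\<in>UNIV. max 0 (a $ i - s)) + 2 * n * (\<Sum>i::'n\<in>UNIV. 0) + n * 0) at_top"
    unfolding \<sigma>_def q_def a_def
    using S(2) w \<epsilon> eventually_mono[OF S(3) subsetD[OF closure_subset]]
    by (intro tendsto_intros std_dev_at_scaled_mean_tendsto_0[OF reg surj bot top]
        closest_point_scaled_tendsto[of "closure S" t0 u w \<tau>]) auto
  moreover have "\<forall>\<^sub>F R in at_top. (\<Sum>i\<in>UNIV. max 0 (w $ i - s)) \<le>
      (\<Sum>i\<in>UNIV. max 0 (a $ i - s)) + 2 * n * (\<Sum>i\<in>UNIV. \<sigma> R i / R) + n * (q R / R)"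
    using eventually_gt_at_top[of 0] S(3)
  proof eventually_elim
    case (elim R)
    let ?U = "\<lambda>x. max 0 (x - R * s)"
    define \<theta> where "\<theta> = (\<chi> i. inv (deriv b) (R * a $ i))"
    have b_\<theta>: "deriv b (\<theta> $ i) = R * a $ i" for i
      using surj by (simp add: \<theta>_def surj_f_inv_f)
    have \<mu>: "(\<chi> i. deriv b (\<theta> $ i)) = R *\<^sub>R a"
      by (simp add: b_\<theta> vec_eq_iff)
    \<comment> \<open>The truthful element may change with \<open>R\<close>; the bound used next is
      the same for all elements that contain the mean.\<close>
    obtain S' where S': "S' \<in> \<S>" "R *\<^sub>R a \<in> S'"
      using cover by blast
    have "(\<Sum>i\<in>UNIV. ?U (closest_point (closure S) (\<chi> i. deriv b (\<theta> $ i)) $ i)) \<le>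
        (\<Sum>i\<in>UNIV. ?U (deriv b (\<theta> $ i))) + 2 * real CARD('n) * (\<Sum>i\<in>UNIV. sqrt (deriv (deriv b) (\<theta> $ i)))"
      using S S' conv elim(2) \<mu> hinge_mono_convex_lipschitz[of "R * s"]
      by (intro truthful_imp_projected_mean_le[OF reg truthful, where S' = S']) auto
    from this[unfolded \<mu>, unfolded b_\<theta>] have proj: "(\<Sum>i\<in>UNIV. ?U (closest_point (closure S) (R *\<^sub>R a) $ i)) \<le>
        (\<Sum>i\<in>UNIV. ?U (R * a $ i)) + 2 * n * (\<Sum>i\<in>UNIV. \<sigma> R i)"
      by (simp add: n_def \<sigma>_def \<theta>_def)
    \<comment> \<open>Moving from the projection to \<open>R *\<^sub>R w\<close> costs at most
      \<open>q R\<close> per coordinate, as the hinge is 1-Lipschitz and monotone.\<close>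
    have "(\<Sum>i\<in>UNIV. ?U (R * w $ i)) \<le> (\<Sum>i\<in>UNIV. ?U (closest_point (closure S) (R *\<^sub>R a) $ i) + q R)"
    proof (rule sum_mono)
      fix i
      have "\<bar>(closest_point (closure S) (R *\<^sub>R a) - R *\<^sub>R w) $ i\<bar> \<le> q R"
        unfolding q_def by (rule component_le_norm_cart)
      then show "?U (R * w $ i) \<le> ?U (closest_point (closure S) (R *\<^sub>R a) $ i) + q R"
        by simp
    qed
    also have "\<dots> = (\<Sum>i\<in>UNIV. ?U (closest_point (closure S) (R *\<^sub>R a) $ i)) + n * q R"
      by (simp add: sum.distrib n_def)
    finally have "(\<Sum>i\<in>UNIV. ?U (R * w $ i)) \<le>
        (\<Sum>i\<in>UNIV. ?U (R * a $ i)) + 2 * n * (\<Sum>i\<in>UNIV. \<sigma> R i) + n * q R"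
      using proj by simp
    then have "(\<Sum>i\<in>UNIV. ?U (R * w $ i)) / R \<le>
        ((\<Sum>i\<in>UNIV. ?U (R * a $ i)) + 2 * n * (\<Sum>i\<in>UNIV. \<sigma> R i) + n * q R) / R"
      using elim(1) by (intro divide_right_mono) simp_all
    moreover
    \<comment> \<open>Scaling point and threshold together scales the hinge, so division by
      \<open>R\<close> removes \<open>R\<close> from these terms.\<close>
    have "?U (R * x) / R = max 0 (x - s)" for x
    proof -
      have "?U (R * x) = R * max 0 (x - s)"
        using elim(1) max_mult_distrib_left[of R 0 "x - s"] by (simp add: right_diff_distrib)
      then show ?thesis using elim(1) by simp
    qed
    then have "(\<Sum>i\<in>UNIV. ?U (R * x $ i)) / R = (\<Sum>i\<in>UNIV. max 0 (x $ i - s))" for x :: "real^'n"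
      by (simp only: sum_divide_distrib)
    ultimately show ?case
      by (simp add: add_divide_distrib sum_divide_distrib[symmetric])
  qed
  ultimately have "(\<Sum>i\<in>UNIV. max 0 (w $ i - s)) \<le>
      (\<Sum>i\<in>UNIV. max 0 (a $ i - s)) + 2 * n * (\<Sum>i::'n\<in>UNIV. 0) + n * 0"
    by (rule tendsto_lowerbound) simp
  then show ?thesis by (simp add: a_def)
qed

section \<open>The hyperplanes of a truthful linear partition\<close>

lemma linear_knowledge_partition_convex_closure:
  assumes "linear_knowledge_partition \<S> K H" and S: "S \<in> \<S>"
    and H: "\<And>k. k \<in> {1..K} \<Longrightarrow> H k = {x. v k \<bullet> x = t k}"
  shows "convex (closure S)"
proof -
  have "(\<Union>k\<in>{1..K}. H k) = (\<Union>k\<in>{1..K}. {x. v k \<bullet> x = t k})"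
    using H by simp
  then obtain C where C: "C \<in> components (UNIV - (\<Union>k\<in>{1..K}. {x. v k \<bullet> x = t k}))"
      "C \<subseteq> S" "S \<subseteq> closure C"
    using assms(1) S unfolding linear_knowledge_partition_def by metis
  then have "closure S = closure C"
    by (metis closure_closure closure_mono subset_antisym)
  then show ?thesis
    using convex_component_hyperplane_arrangement[OF C(1)] by (simp add: convex_closure)
qed

text \<open>Take the largest coordinate of \<open>w\<close> on the support of \<open>u\<close>. With
  a gap of \<open>2 * \<delta>\<close>, the threshold \<open>w $ i - \<delta>\<close> stays at least
  \<open>\<delta>\<close> above all other coordinates in the support.\<close>

lemma ex_max_separating_coordinate:
  fixes u w :: "real^'n"
  assumes "u \<noteq> 0" and inj: "\<And>i j. i \<noteq> j \<Longrightarrow> w $ i \<noteq> w $ j"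
  obtains i \<delta> where "u $ i \<noteq> 0" "0 < \<delta>" "\<And>j. u $ j \<noteq> 0 \<Longrightarrow> j \<noteq> i \<Longrightarrow> w $ j \<le> w $ i - 2 * \<delta>"
proof -
  define J where "J = {j. u $ j \<noteq> 0}"
  have "J \<noteq> {}"
    using \<open>u \<noteq> 0\<close> by (auto simp: J_def vec_eq_iff)
  then have "Max ((\<lambda>j. w $ j) ` J) \<in> (\<lambda>j. w $ j) ` J"
    by (intro Max_in) auto
  then obtain i where i: "i \<in> J" "w $ i = Max ((\<lambda>j. w $ j) ` J)"
    by force
  have less: "w $ j < w $ i" if "j \<in> J" "j \<noteq> i" for j
  proof -
    have "w $ j \<le> w $ i"
      unfolding i(2) using that by (intro Max_ge) auto
    then show ?thesis
      using inj[OF that(2)] by (simp add: order_less_le)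
  qed
  \<comment> \<open>The inserted 1 keeps the minimum defined when the support is a single
    coordinate.\<close>
  define \<delta> where "\<delta> = Min (insert 1 ((\<lambda>j. (w $ i - w $ j) / 2) ` (J - {i})))"
  have "0 < \<delta>"
    unfolding \<delta>_def by (subst Min_gr_iff) (auto simp: less)
  moreover have "w $ j \<le> w $ i - 2 * \<delta>" if "j \<in> J" "j \<noteq> i" for j
  proof -
    have "\<delta> \<le> (w $ i - w $ j) / 2"
      unfolding \<delta>_def using that by (intro Min_le) auto
    then show ?thesis by simp
  qed
  ultimately show thesis
    using that[of i \<delta>] i(1) by (simp add: J_def)
qed

text \<open>The factor \<open>c\<close> is nonzero because \<open>axis i 1\<close> has coordinate
  difference 1, so the equation of the hyperplane can be multiplied by it. Swapping the indices,
  with the constant negated, achieves \<open>i < j\<close>.\<close>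

lemma hyperplane_parallel_coordinate_difference:
  fixes v :: "real^'n::{finite,linorder}"
  assumes "i \<noteq> j" and v: "axis i 1 - axis j 1 = c *\<^sub>R v"
  shows "\<exists>i j s. i < j \<and> {x. v \<bullet> x = t} = {x. x $ i - x $ j = s}"
proof -
  have x: "x $ i - x $ j = c * (v \<bullet> x)" for x
    using arg_cong[OF v, of "\<lambda>y. y \<bullet> x"] by (simp add: inner_diff_left inner_axis')
  have "c \<noteq> 0"
    using x[of "axis i 1"] \<open>i \<noteq> j\<close> by (auto simp: axis_def)
  then have 1: "v \<bullet> x = t \<longleftrightarrow> x $ i - x $ j = c * t" for x
    unfolding x by simp
  then have 2: "v \<bullet> x = t \<longleftrightarrow> x $ j - x $ i = - (c * t)" for x
    unfolding 1 by linarith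
  show ?thesis
  proof (cases "i < j")
    case True
    then show ?thesis using 1 by blast
  next
    case False
    then have "j < i" using \<open>i \<noteq> j\<close> by simp
    then show ?thesis using 2 by blast
  qed
qed

theorem theorem3:
  fixes \<rho> :: "real measure" and c b :: "real \<Rightarrow> real"
    and \<S> :: "(real ^ 'n::{finite,linorder}) set set"
    and K :: nat and H :: "nat \<Rightarrow> (real ^ 'n::{finite,linorder}) set"
  assumes "CARD('n) \<ge> 2"
    and "regular_exp_family \<rho> c b"
    and "range (deriv b) = UNIV"
    and "filterlim (\<lambda>\<theta>. deriv b \<theta> / sqrt (deriv (deriv b) \<theta>)) at_bot at_bot"
    and "filterlim (\<lambda>\<theta>. deriv b \<theta> / sqrt (deriv (deriv b) \<theta>)) at_top at_top"
    and "linear_knowledge_partition \<S> K H"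
    and "truthful (exp_family \<rho> c b) b \<S>"
  shows "\<forall>k\<in>{1..K}. \<exists>i j t. i < j \<and> H k = {x. x $ i - x $ j = t}"
proof (rule ballI, rule ccontr)
  fix k0 assume k0: "k0 \<in> {1..K}" and contra: "\<not> (\<exists>i j t. i < j \<and> H k0 = {x. x $ i - x $ j = t})"
  have "\<forall>k\<in>{1..K}. \<exists>a b. a \<noteq> 0 \<and> H k = {x. a \<bullet> x = b}"
  proof
    fix k assume "k \<in> {1..K}"
    then have "affine_hyperplane (H k)"
      using assms(6) by (simp add: linear_knowledge_partition_def)
    then show "\<exists>a b. a \<noteq> 0 \<and> H k = {x. a \<bullet> x = b}"
      by (rule affine_hyperplane_eq)
  qed
  then obtain v t where v: "\<And>k. k \<in> {1..K} \<Longrightarrow> v k \<noteq> 0"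
      and H: "\<And>k. k \<in> {1..K} \<Longrightarrow> H k = {x. v k \<bullet> x = t k}"
    by metis
  have Hs: "(\<Union>k\<in>{1..K}. H k) = (\<Union>k\<in>{1..K}. {x. v k \<bullet> x = t k})"
    using H by simp
  \<comment> \<open>The vectors to which \<open>w\<close> must not be orthogonal: the differences of
    axes make its coordinates distinct, the other normals make it transversal to the hyperplanes not
    parallel to \<open>H k0\<close>.\<close>
  define F where "F = (\<lambda>(i, j). axis i 1 - axis j 1) ` {(i, j). i \<noteq> j} \<union>
      v ` {k \<in> {1..K}. \<forall>c. v k \<noteq> c *\<^sub>R v k0}"
  have "\<exists>w. v k0 \<bullet> w = 0 \<and> (\<forall>f\<in>F. f \<bullet> w \<noteq> 0)"
  proof (rule generic_orthogonal_vector)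
    show "finite F" by (simp add: F_def)
    \<comment> \<open>Here the assumption for contradiction enters: a normal parallel to a
      difference of axes would give \<open>H k0\<close> the claimed form.\<close>
    have axis: "axis i 1 - axis j 1 \<noteq> c *\<^sub>R v k0" if "i \<noteq> j" for i j c
    proof
      assume "axis i 1 - axis j 1 = c *\<^sub>R v k0"
      from hyperplane_parallel_coordinate_difference[OF that this, of "t k0"] show False
        using contra unfolding H[OF k0] by contradiction
    qed
    show "f \<noteq> c *\<^sub>R v k0" if "f \<in> F" for f c
      using that by (auto simp: F_def not_sym[OF axis]) metis
  qed
  then obtain w where w: "v k0 \<bullet> w = 0" "\<And>f. f \<in> F \<Longrightarrow> f \<bullet> w \<noteq> 0"
    by blast
  have inj: "w $ i \<noteq> w $ j" if "i \<noteq> j" for i j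
  proof -
    have "axis i 1 - axis j 1 \<in> F"
      unfolding F_def using that by (intro UnI1 image_eqI[of _ _ "(i, j)"]) auto
    from w(2)[OF this] show ?thesis
      by (simp add: inner_diff_left inner_axis')
  qed
  obtain i \<delta> where i: "v k0 $ i \<noteq> 0" and \<delta>: "0 < \<delta>"
      and gap: "\<And>j. v k0 $ j \<noteq> 0 \<Longrightarrow> j \<noteq> i \<Longrightarrow> w $ j \<le> w $ i - 2 * \<delta>"
    using ex_max_separating_coordinate[OF v[OF k0] inj] by blast
  \<comment> \<open>The sign is chosen so that \<open>u $ i > 0\<close>: moving from
    \<open>w\<close> against \<open>u\<close> then lowers the critical coordinate
    \<open>i\<close>.\<close>
  define r where "r = sgn (v k0 $ i)"
  define u where "u = r *\<^sub>R v k0"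
  have r: "r \<noteq> 0" "r * r = 1"
    using i by (auto simp: r_def sgn_if)
  have u: "u \<noteq> 0" "u \<bullet> w = 0" "0 < u $ i"
    using v[OF k0] r w(1) i by (auto simp: u_def r_def sgn_mult_abs sgn_if)
  have Hu: "{x. v k0 \<bullet> x = t k0} = {x. u \<bullet> x = r * t k0}"
    using r by (simp add: u_def)
  have gen: "(\<exists>c. v k = c *\<^sub>R u) \<or> v k \<bullet> w \<noteq> 0" if "k \<in> {1..K}" for k
  proof (cases "\<exists>c. v k = c *\<^sub>R v k0")
    case True
    then obtain c where "v k = c *\<^sub>R v k0" by blast
    then have "v k = (c * r) *\<^sub>R u"
      using r by (simp add: u_def mult.assoc)
    then show ?thesis by blast
  next
    case False
    then show ?thesis using w(2)[of "v k"] that by (auto simp: F_def)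
  qed
  obtain C \<tau> where C: "C \<in> components (UNIV - (\<Union>k\<in>{1..K}. {x. v k \<bullet> x = t k}))"
      "C \<subseteq> {x. r * t k0 \<le> u \<bullet> x}" "\<forall>\<^sub>F R in at_top. R *\<^sub>R w + \<tau> *\<^sub>R u \<in> C"
    by (rule ex_component_containing_ray[of "{1..K}" v k0 t u "r * t k0" w, OF _ v k0 Hu u(1,2) gen]) auto
  obtain S where S: "S \<in> \<S>" "C \<subseteq> S" "S \<subseteq> closure C"
  proof -
    have "\<forall>C\<in>components (UNIV - (\<Union>k\<in>{1..K}. H k)). \<exists>S\<in>\<S>. C \<subseteq> S \<and> S \<subseteq> closure C"
      using assms(6) unfolding linear_knowledge_partition_def by (elim conjE)
    from bspec[OF this[unfolded Hs] C(1)] show ?thesis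
      using that by blast
  qed
  have closed: "closed {x. r * t k0 \<le> u \<bullet> x}"
    using closed_halfspace_ge[of "r * t k0" u] by simp
  have "closure S \<subseteq> {x. r * t k0 \<le> u \<bullet> x}"
    using S(3) closure_minimal[OF C(2) closed] by (intro closure_minimal closed) blast
  moreover have "\<forall>\<^sub>F R in at_top. R *\<^sub>R w + \<tau> *\<^sub>R u \<in> S"
    by (rule eventually_mono[OF C(3) subsetD[OF S(2)]])
  moreover
  \<comment> \<open>So small that the perturbation changes no coordinate by more than
    \<open>\<delta>\<close>.\<close>
  define \<epsilon> where "\<epsilon> = \<delta> / (1 + norm u)"
  have \<epsilon>: "0 < \<epsilon>" "\<epsilon> * norm u \<le> \<delta>"
  proof -
    have "0 < 1 + norm u" by (simp add: add_pos_nonneg)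
    then show "0 < \<epsilon>" "\<epsilon> * norm u \<le> \<delta>"
      using \<delta> by (simp_all add: \<epsilon>_def pos_divide_le_eq distrib_left)
  qed
  moreover have "\<Union>\<S> = UNIV"
    using assms(6) by (simp add: linear_knowledge_partition_def knowledge_partition_def)
  ultimately have "(\<Sum>j\<in>UNIV. max 0 (w $ j - (w $ i - \<delta>))) \<le>
      (\<Sum>j\<in>UNIV. max 0 (w $ j - \<epsilon> * u $ j - (w $ i - \<delta>)))"
    using linear_knowledge_partition_convex_closure[OF assms(6) _ H] S(1) u(2)
    by (intro truthful_imp_weak_majorization[OF assms(2-5,7)]) auto
  \<comment> \<open>At the threshold \<open>w $ i - \<delta>\<close>, coordinates outside the
    support of \<open>u\<close> do not change, those in the support other than \<open>i\<close> have
    hinge 0 before and after the perturbation, and the hinge at \<open>i\<close> falls strictly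
    below \<open>\<delta>\<close>.\<close>
  moreover have "(\<Sum>j\<in>UNIV. max 0 (w $ j - \<epsilon> * u $ j - (w $ i - \<delta>))) <
      (\<Sum>j\<in>UNIV. max 0 (w $ j - (w $ i - \<delta>)))"
  proof (rule sum_strict_mono_ex1)
    have pos: "0 < \<epsilon> * u $ i"
      using \<epsilon>(1) u(3) by simp
    show "\<forall>j\<in>UNIV. max 0 (w $ j - \<epsilon> * u $ j - (w $ i - \<delta>)) \<le> max 0 (w $ j - (w $ i - \<delta>))"
    proof
      fix j
      consider "u $ j = 0" | "j = i" | "u $ j \<noteq> 0" "j \<noteq> i" by blast
      then show "max 0 (w $ j - \<epsilon> * u $ j - (w $ i - \<delta>)) \<le> max 0 (w $ j - (w $ i - \<delta>))"
      proof cases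
        case 2
        then show ?thesis using pos by simp
      next
        case 3
        then have "w $ j \<le> w $ i - 2 * \<delta>"
          using gap by (simp add: u_def)
        moreover have "- (\<epsilon> * u $ j) \<le> \<delta>"
        proof -
          have "\<epsilon> * - (u $ j) \<le> \<epsilon> * norm u"
            using component_le_norm_cart[of u j] \<epsilon>(1) by (intro mult_left_mono) auto
          then show ?thesis using \<epsilon>(2) by simp
        qed
        ultimately show ?thesis by simp
      qed simp
    qed
    show "\<exists>j\<in>UNIV. max 0 (w $ j - \<epsilon> * u $ j - (w $ i - \<delta>)) < max 0 (w $ j - (w $ i - \<delta>))"
      using \<delta> pos by (intro bexI[of _ i]) auto
  qed simp
  ultimately show False by simp
qed

end
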